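(* Let $f_1,\dots,f_m\in C^1(\mathbb{R}^n)$ have gradients that are Lipschitz on $\mathbb{R}^n$ with constants $L_i\ge0$. Fix $\tau>0$, $\delta>0$, $\vartheta>1$, $c_1,\rho\in(0,1)$ and $z_0\in\mathbb{R}^{n+1}$, and suppose that $\mathcal{L}_\tau(z_0)=\{z\in\mathbb{R}^{n+1}:\Phi_\tau(z)\le\Phi_\tau(z_0)\}$ is compact. Consider a run of the algorithm described in the context, with $b_k\ne0$ and $0\le\mu_k\le\mu_k^\star$ at every nonrestart iteration. Let $M_\tau<\infty$ be a constant with $P_k\preceq M_\tau I$ for every iterate, let $\underline\alpha=\rho\min\{1,2(1-c_1)(1-\vartheta^{-2})\}$, and let $$\Delta_\tau=\Phi_\tau(z_0)-\inf_{z\in\mathcal{L}_\tau(z_0)}\Phi_\tau(z).$$ Then for every $N\ge0$ such that the iterates $z_0,\dots,z_N$ are generated, $$\min_{0\le k\le N}\|g_k\|^2\le\frac{M_\tau\Delta_\tau}{c_1\underline\alpha\,(N+1)} .$$ Consequently, $O(\varepsilon^{-2})$ iterations are sufficient to obtain $\|g_k\|\le\varepsilon$ (with the constant in $O(\cdot)$ independent of $\varepsilon>0$, for fixed $\tau$).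
   Context: $\bar L=\sum_i L_i$; $\phi_\tau(r)=\frac{r+\sqrt{r^2+\tau^2}}{2}$; $\Phi_\tau(x,t)=t+\sum_{i=1}^m\phi_\tau(f_i(x)-t)$ on $\mathbb{R}^{n+1}$. At $z_k=(x_k,t_k)$ let $\omega_{i,k}=\sqrt{(f_i(x_k)-t_k)^2+\tau^2}$, $J_k$ the $m\times(n+1)$ matrix with rows $(\nabla f_i(x_k)^T,-1)$, $D_k=\operatorname{diag}(\omega_{1,k}^{-1},\dots,\omega_{m,k}^{-1})$, $\Pi_x=\operatorname{diag}(I_n,0)$, and $P_k=\delta I_{n+1}+\bar L\Pi_x+\frac12J_k^TD_kJ_k$, a symmetric positive definite matrix. One admissible $M_\tau$ is $\delta+\bar L+\frac1{2\tau}\sum_{i=1}^m(G_i^2+1)$, where $G_i$ bounds $\|\nabla f_i(x)\|$ on the $x$-projection of $\mathcal{L}_\tau(z_0)$. Algorithm. For $k=0,1,2,\dots$: (1) compute $g_k=\nabla\Phi_\tau(z_k)$; stop if $g_k=0$. (2) If $k=0$, set $d_k=-P_k^{-1}g_k$. If $k\ge1$, set $s_{k-1}=z_k-z_{k-1}$ and choose a curvature response $b_k\in\mathbb{R}^{n+1}$ by any rule. If $s_{k-1}=0$ or $b_k=0$, restart: $d_k=-P_k^{-1}g_k$. Otherwise (nonrestart iteration) put $C_k=s_{k-1}^TP_ks_{k-1}$, $B_k=b_k^TP_k^{-1}b_k$, $\Delta_k=s_{k-1}^Tb_k$, $\chi_k=\Delta_k/\sqrt{C_kB_k}$, $\mathcal{D}_k=\Delta_k+\vartheta\sqrt{C_kB_k}$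 (positive), $\varpi_k^2=\frac{1-\chi_k^2}{(\vartheta+\chi_k)^2}$, $\Gamma_0=\frac{\vartheta^2}{\vartheta^2-1}$, $\mu_k^\star=\frac{\Gamma_0-1-\varpi_k^2}{\sqrt{\Gamma_0}+1}$, choose any $\mu_k\in[0,\mu_k^\star]$, and set $$d_k=-P_k^{-1}g_k+\left[\frac{g_k^TP_k^{-1}b_k}{\mathcal{D}_k}-\mu_k\frac{g_k^Ts_{k-1}}{C_k}\right]s_{k-1}-\frac{g_k^Ts_{k-1}}{\mathcal{D}_k}P_k^{-1}b_k.$$ (3) Let $\alpha_k$ be the first element of $1,\rho,\rho^2,\dots$ satisfying $\Phi_\tau(z_k+\alpha_kd_k)\le\Phi_\tau(z_k)+c_1\alpha_kg_k^Td_k$, and set $z_{k+1}=z_k+\alpha_kd_k$. *)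

theory Defs
  imports "HOL-Analysis.Analysis"
begin

text \<open>
  A point \<open>z = (x, t)\<close> of the \<open>(n + 1)\<close>-dimensional space is a vector of type
  \<open>real ^ ('n option)\<close>: the indices \<open>Some j\<close> carry the coordinates of \<open>x\<close>, the index \<open>None\<close>
  carries \<open>t\<close>.
\<close>

type_synonym 'n point = "real ^ ('n option)"
type_synonym 'n square_matrix = "real ^ ('n option) ^ ('n option)"

definition x_part :: "('n::finite) point \<Rightarrow> real ^ 'n" where
  "x_part z = (\<chi> j. z $ Some j)"

definition t_part :: "('n::finite) point \<Rightarrow> real" where
  "t_part z = z $ None"


text \<open>Meaningful only at points of differentiability, where the gradient is unique.\<close>

definition gradient :: "('a::real_inner \<Rightarrow> real) \<Rightarrow> 'a \<Rightarrow> 'a" where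
  "gradient h x = (THE D. GDERIV h x :> D)"

definition C1_function :: "('a::real_inner \<Rightarrow> real) \<Rightarrow> bool" where
  "C1_function h \<longleftrightarrow> (\<forall>x. h differentiable (at x)) \<and> continuous_on UNIV (gradient h)"

definition diag_matrix :: "real ^ 'k \<Rightarrow> real ^ 'k ^ ('k::finite)" where
  "diag_matrix v = (\<chi> i j. if i = j then v $ i else 0)"

definition pos_semidef :: "real ^ 'k ^ ('k::finite) \<Rightarrow> bool" where
  "pos_semidef A \<longleftrightarrow> transpose A = A \<and> (\<forall>v. 0 \<le> v \<bullet> (A *v v))"

definition loewner_le :: "real ^ 'k ^ ('k::finite) \<Rightarrow> real ^ 'k ^ 'k \<Rightarrow> bool"
    (infix \<open>\<preceq>\<^sub>L\<close> 50) where
  "A \<preceq>\<^sub>L B \<longleftrightarrow> pos_semidef (B - A)"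


definition smooth_plus :: "real \<Rightarrow> real \<Rightarrow> real" where
  "smooth_plus \<tau> r = (r + sqrt (r\<^sup>2 + \<tau>\<^sup>2)) / 2"

definition Phi :: "('m::finite \<Rightarrow> real ^ 'n \<Rightarrow> real) \<Rightarrow> real \<Rightarrow> ('n::finite) point \<Rightarrow> real" where
  "Phi f \<tau> z = t_part z + (\<Sum>i\<in>UNIV. smooth_plus \<tau> (f i (x_part z) - t_part z))"

definition level_set ::
  "('m::finite \<Rightarrow> real ^ 'n \<Rightarrow> real) \<Rightarrow> real \<Rightarrow> ('n::finite) point \<Rightarrow> 'n point set" where
  "level_set f \<tau> z0 = {z. Phi f \<tau> z \<le> Phi f \<tau> z0}"

definition Phi_gap :: "('m::finite \<Rightarrow> real ^ 'n \<Rightarrow> real) \<Rightarrow> real \<Rightarrow> ('n::finite) point \<Rightarrow> real" where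
  "Phi_gap f \<tau> z0 = Phi f \<tau> z0 - (INF z\<in>level_set f \<tau> z0. Phi f \<tau> z)"

definition omega ::
  "('m::finite \<Rightarrow> real ^ 'n \<Rightarrow> real) \<Rightarrow> real \<Rightarrow> ('n::finite) point \<Rightarrow> 'm \<Rightarrow> real" where
  "omega f \<tau> z i = sqrt ((f i (x_part z) - t_part z)\<^sup>2 + \<tau>\<^sup>2)"

definition J_matrix ::
  "('m::finite \<Rightarrow> real ^ 'n \<Rightarrow> real) \<Rightarrow> ('n::finite) point \<Rightarrow> real ^ ('n option) ^ 'm" where
  "J_matrix f z =
     (\<chi> i j. case j of Some l \<Rightarrow> gradient (f i) (x_part z) $ l | None \<Rightarrow> - 1)"

definition D_matrix ::
  "('m::finite \<Rightarrow> real ^ 'n \<Rightarrow> real) \<Rightarrow> real \<Rightarrow> ('n::finite) point \<Rightarrow> real ^ 'm ^ 'm" where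
  "D_matrix f \<tau> z = diag_matrix (\<chi> i. inverse (omega f \<tau> z i))"

definition Pi_x :: "('n::finite) square_matrix" where
  "Pi_x = diag_matrix (\<chi> j. case j of Some l \<Rightarrow> 1 | None \<Rightarrow> 0)"

definition P_matrix ::
  "('m::finite \<Rightarrow> real ^ 'n \<Rightarrow> real) \<Rightarrow> ('m \<Rightarrow> real) \<Rightarrow> real \<Rightarrow> real
     \<Rightarrow> ('n::finite) point \<Rightarrow> 'n square_matrix" where
  "P_matrix f L \<tau> \<delta> z =
     \<delta> *\<^sub>R mat 1 + (\<Sum>i\<in>UNIV. L i) *\<^sub>R Pi_x
       + (1 / 2) *\<^sub>R (transpose (J_matrix f z) ** D_matrix f \<tau> z ** J_matrix f z)"


text \<open>
  Scalars of a nonrestart iteration, as functions of the metric \<open>P\<close>, the previous displacement \<open>s\<close>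
  and the curvature response \<open>b\<close>. The constant \<open>CB_root P s b\<close> is the square root of
  \<open>C\<^sub>k B\<^sub>k\<close>.
\<close>

definition CB_root :: "real ^ 'k ^ 'k \<Rightarrow> real ^ 'k \<Rightarrow> real ^ ('k::finite) \<Rightarrow> real" where
  "CB_root P s b = sqrt ((s \<bullet> (P *v s)) * (b \<bullet> (matrix_inv P *v b)))"

definition chi_cos :: "real ^ 'k ^ 'k \<Rightarrow> real ^ 'k \<Rightarrow> real ^ ('k::finite) \<Rightarrow> real" where
  "chi_cos P s b = (s \<bullet> b) / CB_root P s b"

definition D_scalar ::
  "real \<Rightarrow> real ^ 'k ^ 'k \<Rightarrow> real ^ 'k \<Rightarrow> real ^ ('k::finite) \<Rightarrow> real" where
  "D_scalar \<theta> P s b = s \<bullet> b + \<theta> * CB_root P s b"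

definition varpi_sq ::
  "real \<Rightarrow> real ^ 'k ^ 'k \<Rightarrow> real ^ 'k \<Rightarrow> real ^ ('k::finite) \<Rightarrow> real" where
  "varpi_sq \<theta> P s b = (1 - (chi_cos P s b)\<^sup>2) / (\<theta> + chi_cos P s b)\<^sup>2"

definition Gamma0 :: "real \<Rightarrow> real" where
  "Gamma0 \<theta> = \<theta>\<^sup>2 / (\<theta>\<^sup>2 - 1)"

definition mu_star ::
  "real \<Rightarrow> real ^ 'k ^ 'k \<Rightarrow> real ^ 'k \<Rightarrow> real ^ ('k::finite) \<Rightarrow> real" where
  "mu_star \<theta> P s b = (Gamma0 \<theta> - 1 - varpi_sq \<theta> P s b) / (sqrt (Gamma0 \<theta>) + 1)"

definition restart_direction :: "real ^ 'k ^ 'k \<Rightarrow> real ^ 'k \<Rightarrow> real ^ ('k::finite)" where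
  "restart_direction P g = - (matrix_inv P *v g)"

definition nonrestart_direction ::
  "real \<Rightarrow> real ^ 'k ^ 'k \<Rightarrow> real ^ 'k \<Rightarrow> real ^ 'k \<Rightarrow> real ^ 'k \<Rightarrow> real
     \<Rightarrow> real ^ ('k::finite)" where
  "nonrestart_direction \<theta> P g s b \<mu> =
     - (matrix_inv P *v g)
     + ((g \<bullet> (matrix_inv P *v b)) / D_scalar \<theta> P s b - \<mu> * ((g \<bullet> s) / (s \<bullet> (P *v s)))) *\<^sub>R s
     - ((g \<bullet> s) / D_scalar \<theta> P s b) *\<^sub>R (matrix_inv P *v b)"


text \<open>
  First element of \<open>1, \<rho>, \<rho>\<^sup>2, \<dots>\<close> passing the sufficient decrease test. That some element
  passes is not built in: otherwise \<open>LEAST\<close> is unspecified and nothing is known about the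
  step length.
\<close>

definition armijo_step ::
  "('a::real_inner \<Rightarrow> real) \<Rightarrow> real \<Rightarrow> real \<Rightarrow> 'a \<Rightarrow> 'a \<Rightarrow> 'a \<Rightarrow> real" where
  "armijo_step F c1 \<rho> z g d =
     \<rho> ^ (LEAST j. F (z + (\<rho> ^ j) *\<^sub>R d) \<le> F z + c1 * \<rho> ^ j * (g \<bullet> d))"

definition alpha_low :: "real \<Rightarrow> real \<Rightarrow> real \<Rightarrow> real" where
  "alpha_low \<theta> c1 \<rho> = \<rho> * min 1 (2 * (1 - c1) * (1 - inverse (\<theta>\<^sup>2)))"

text \<open>
  The point \<open>z N\<close> is generated if the stopping test failed at all earlier points. Entries of the
  sequence \<open>z\<close> behind the stopping index are not iterates and are left unconstrained by \<open>is_run\<close>.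
\<close>

definition generated ::
  "('m::finite \<Rightarrow> real ^ 'n \<Rightarrow> real) \<Rightarrow> real \<Rightarrow> (nat \<Rightarrow> ('n::finite) point) \<Rightarrow> nat \<Rightarrow> bool" where
  "generated f \<tau> z N \<longleftrightarrow> (\<forall>j<N. gradient (Phi f \<tau>) (z j) \<noteq> 0)"

text \<open>
  Run with iterates \<open>z\<close>, arbitrary curvature responses \<open>b\<close> and parameters \<open>\<mu>\<close>; the values \<open>b 0\<close>,
  and \<open>\<mu> k\<close> at restarts, are not used.
\<close>

definition is_run ::
  "('m::finite \<Rightarrow> real ^ 'n \<Rightarrow> real) \<Rightarrow> ('m \<Rightarrow> real) \<Rightarrow> real \<Rightarrow> real \<Rightarrow> real \<Rightarrow> real \<Rightarrow> real
     \<Rightarrow> ('n::finite) point \<Rightarrow> (nat \<Rightarrow> 'n point) \<Rightarrow> (nat \<Rightarrow> 'n point) \<Rightarrow> (nat \<Rightarrow> real) \<Rightarrow> bool" where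
  "is_run f L \<tau> \<delta> \<theta> c1 \<rho> z0 z b \<mu> \<longleftrightarrow>
     z 0 = z0 \<and>
     (\<forall>k. generated f \<tau> z k \<and> gradient (Phi f \<tau>) (z k) \<noteq> 0 \<longrightarrow>
        (let g = gradient (Phi f \<tau>) (z k);
             P = P_matrix f L \<tau> \<delta> (z k);
             s = z k - z (k - 1);
             restart = (k = 0 \<or> s = 0 \<or> b k = 0);
             d = (if restart then restart_direction P g
                  else nonrestart_direction \<theta> P g s (b k) (\<mu> k))
         in (\<not> restart \<longrightarrow> 0 \<le> \<mu> k \<and> \<mu> k \<le> mu_star \<theta> P s (b k)) \<and>
            z (Suc k) = z k + armijo_step (Phi f \<tau>) c1 \<rho> (z k) g d *\<^sub>R d))"

end

theory Submission
  imports Defs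
begin

text \<open>
  The method is a preconditioned descent method whose metric \<open>P\<^sub>k\<close> is an upper model of the curvature of the
  objective: \<open>\<Phi>(z\<^sub>k + p) \<le> \<Phi>(z\<^sub>k) + g\<^sub>k\<^sup>T p + p\<^sup>T P\<^sub>k p / 2\<close> for every \<open>p\<close>, globally
  (\<open>Phi_majorant\<close>). For any direction \<open>d\<close> with \<open>d\<^sup>T P\<^sub>k d \<le> \<Gamma>\<^sub>0 (- g\<^sub>k\<^sup>T d)\<close>
  this majorant makes every trial step up to \<open>2 (1 - c1) / \<Gamma>\<^sub>0\<close> pass the decrease test, so backtracking
  stops at a step of at least \<open>alpha_low\<close> (\<open>armijo_step_bounds\<close>).

  What has to be shown about the directions is therefore this inequality, with
  \<open>\<Gamma>\<^sub>0 = \<theta>\<^sup>2 / (\<theta>\<^sup>2 - 1)\<close>, and enough descent. Seen in the inner product of \<open>P\<^sub>k\<close>, the correction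
  added to \<open>- P\<^sub>k\<^sup>-\<^sup>1 g\<^sub>k\<close> consists of a skew map, which does not change \<open>g\<^sub>k\<^sup>T d\<close>, and a damping along the
  previous displacement, which only helps descent; so \<open>- g\<^sub>k\<^sup>T d \<ge> g\<^sub>k\<^sup>T P\<^sub>k\<^sup>-\<^sup>1 g\<^sub>k\<close>. The correction lives in
  a plane, and there the inequality is the nonnegativity of a binary quadratic form whose determinant
  factors (\<open>rotated_plane_bound\<close>); the admissible range of \<open>\<mu>\<^sub>k\<close> makes both factors nonnegative
  (\<open>nonrestart_direction_bounds\<close>).

  Since \<open>P\<^sub>k \<preceq> M I\<close> gives \<open>g\<^sub>k\<^sup>T P\<^sub>k\<^sup>-\<^sup>1 g\<^sub>k \<ge> \<parallel>g\<^sub>k\<parallel>\<^sup>2 / M\<close>, each iteration lowers \<open>\<Phi>\<close> by at least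
  \<open>c1 alpha_low \<parallel>g\<^sub>k\<parallel>\<^sup>2 / M\<close> (\<open>iteration_decrease\<close>). All iterates stay in the compact initial level set,
  where \<open>\<Phi>\<close> is bounded below, so the total decrease is at most the gap, and the smallest of the
  \<open>N + 1\<close> squared gradient norms is at most their average. The complexity bound is this rate at
  \<open>N = \<lfloor>C / \<epsilon>\<^sup>2\<rfloor>\<close>.
\<close>

section \<open>Gradients and the descent lemma\<close>

text \<open>
  The gradient is a definite description, so it has to be produced first: the Riesz vector of the
  Frechet derivative is obtained by expanding the argument in the orthonormal basis.
\<close>

lemma has_derivative_gradient:
  fixes h :: "'a::euclidean_space \<Rightarrow> real"
  assumes "h differentiable (at x)"
  shows "(h has_derivative (\<lambda>p. p \<bullet> gradient h x)) (at x)"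
proof -
  obtain h' where h': "(h has_derivative h') (at x)"
    using assms by (auto simp: differentiable_def)
  interpret bounded_linear h' using h' by (rule has_derivative_bounded_linear)
  have "h' = (\<lambda>p. p \<bullet> (\<Sum>b\<in>Basis. h' b *\<^sub>R b))"
  proof
    fix p
    have "h' p = h' (\<Sum>b\<in>Basis. (p \<bullet> b) *\<^sub>R b)" by (simp add: euclidean_representation)
    also have "\<dots> = p \<bullet> (\<Sum>b\<in>Basis. h' b *\<^sub>R b)"
      by (simp add: sum scaleR inner_sum_right mult.commute)
    finally show "h' p = p \<bullet> (\<Sum>b\<in>Basis. h' b *\<^sub>R b)" .
  qed
  then have "GDERIV h x :> (\<Sum>b\<in>Basis. h' b *\<^sub>R b)"
    using h' unfolding gderiv_def by metis
  moreover have "D = D'" if "GDERIV h x :> D" "GDERIV h x :> D'" for D D'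
  proof -
    have "(\<lambda>p. p \<bullet> D) = (\<lambda>p. p \<bullet> D')"
      using that unfolding gderiv_def by (rule has_derivative_unique)
    then show ?thesis by (metis inner_commute vector_eq_ldot)
  qed
  ultimately have "GDERIV h x :> gradient h x"
    unfolding gradient_def by (metis theI)
  then show ?thesis by (simp add: gderiv_def)
qed

lemma gradient_inner_eq:
  fixes h :: "'a::euclidean_space \<Rightarrow> real"
  assumes "(h has_derivative h') (at x)"
  shows "gradient h x \<bullet> p = h' p"
proof -
  have "h differentiable (at x)" using assms by (auto simp: differentiable_def)
  from has_derivative_unique[OF assms has_derivative_gradient[OF this]]
  show ?thesis by (simp add: inner_commute)
qed

text \<open>
  Subtracting the claimed bound along the segment from \<open>x\<close> to \<open>x + p\<close> leaves a function of one real
  variable whose derivative is nonpositive, by Cauchy-Schwarz and the Lipschitz bound.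
\<close>

lemma descent_lemma:
  fixes h :: "'a::euclidean_space \<Rightarrow> real"
  assumes diff: "\<And>x. h differentiable (at x)"
    and lip: "L-lipschitz_on UNIV (gradient h)"
  shows "h (x + p) \<le> h x + gradient h x \<bullet> p + L / 2 * (p \<bullet> p)"
proof -
  define r where "r a = h (x + a *\<^sub>R p) - a * (gradient h x \<bullet> p) - L / 2 * a\<^sup>2 * (p \<bullet> p)" for a :: real
  have deriv: "(r has_real_derivative
      (gradient h (x + a *\<^sub>R p) - gradient h x) \<bullet> p - L * a * (p \<bullet> p)) (at a)" for a
  proof -
    have "((\<lambda>a. x + a *\<^sub>R p) has_derivative (\<lambda>e. e *\<^sub>R p)) (at a)"
      by (auto intro!: derivative_eq_intros)
    from has_derivative_compose[OF this has_derivative_gradient[OF diff]]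
    have "((\<lambda>a. h (x + a *\<^sub>R p)) has_real_derivative p \<bullet> gradient h (x + a *\<^sub>R p)) (at a)"
      by (simp add: has_field_derivative_def mult_commute_abs)
    then show ?thesis unfolding r_def
      by (auto intro!: derivative_eq_intros simp: inner_diff_right inner_commute)
  qed
  have "r 1 \<le> r 0"
  proof (rule DERIV_nonpos_imp_nonincreasing[of 0 1 r])
    fix a :: real assume a: "0 \<le> a" "a \<le> 1"
    have "(gradient h (x + a *\<^sub>R p) - gradient h x) \<bullet> p
        \<le> norm (gradient h (x + a *\<^sub>R p) - gradient h x) * norm p"
      by (rule norm_cauchy_schwarz)
    also have "\<dots> \<le> (L * norm (a *\<^sub>R p)) * norm p"
      using lipschitz_onD[OF lip, of "x + a *\<^sub>R p" x]
      by (intro mult_right_mono) (auto simp: dist_norm)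
    also have "\<dots> = L * a * (p \<bullet> p)"
      using a by (simp add: dot_square_norm power2_eq_square)
    finally show "\<exists>y. (r has_real_derivative y) (at a) \<and> y \<le> 0"
      using deriv by fastforce
  qed simp
  then show ?thesis by (simp add: r_def)
qed

section \<open>The smoothed plus function\<close>

lemma has_real_derivative_smooth_plus:
  assumes "\<tau> > 0"
  shows "(smooth_plus \<tau> has_real_derivative (1 + r / sqrt (r\<^sup>2 + \<tau>\<^sup>2)) / 2) (at r)"
proof -
  have "r\<^sup>2 + \<tau>\<^sup>2 > 0" using assms by (simp add: add_nonneg_pos)
  then show ?thesis unfolding smooth_plus_def
    by (auto intro!: derivative_eq_intros simp: field_simps)
qed

text \<open>
  The square root is concave as a function of \<open>r\<^sup>2\<close>, so its tangent in the variable \<open>r\<^sup>2\<close> lies above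
  it. Read as a function of \<open>r\<close>, this tangent is a parabola with curvature \<open>1 / w r\<close>: it is the reason
  why the weights \<open>inverse \<omega>\<^sub>i\<close>, rather than the second derivatives themselves, enter the metric: those are
  no upper model away from the point where they are taken.
\<close>

lemma smooth_plus_quadratic_bound:
  assumes "\<tau> > 0"
  defines "w r \<equiv> sqrt (r\<^sup>2 + \<tau>\<^sup>2)"
  shows "smooth_plus \<tau> (r + q) \<le> smooth_plus \<tau> r + (1 + r / w r) / 2 * q + q\<^sup>2 / (4 * w r)"
proof -
  have pos: "w r > 0" for r using assms by (simp add: w_def add_nonneg_pos)
  have sq: "(w r)\<^sup>2 = r\<^sup>2 + \<tau>\<^sup>2" for r by (simp add: w_def)
  have "0 \<le> (w (r + q) - w r)\<^sup>2" by simp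
  then have "2 * w (r + q) * w r \<le> (w r)\<^sup>2 + (w (r + q))\<^sup>2"
    by (simp add: power2_diff)
  also have "\<dots> = 2 * (w r)\<^sup>2 + 2 * r * q + q\<^sup>2"
    by (simp add: sq power2_sum)
  finally have "w (r + q) \<le> w r + r / w r * q + q\<^sup>2 / (2 * w r)"
    using pos[of r] by (simp add: field_simps power2_eq_square)
  moreover have "smooth_plus \<tau> (r + q) = (r + q + w (r + q)) / 2" "smooth_plus \<tau> r = (r + w r) / 2"
    by (simp_all add: smooth_plus_def w_def)
  ultimately show ?thesis by (simp add: field_simps)
qed

text \<open>
  The smoothed plus function is nondecreasing and 1-Lipschitz. Hence an error term in an upper bound of
  the argument passes through it without amplification.
\<close>

lemma smooth_plus_add_le:
  assumes "\<tau> > 0" "u \<le> v + c" "0 \<le> c"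
  shows "smooth_plus \<tau> u \<le> smooth_plus \<tau> v + c"
proof -
  \<comment> \<open>The square root is the norm of a vector in the plane, hence 1-Lipschitz in its first entry.\<close>
  have "sqrt (u\<^sup>2 + \<tau>\<^sup>2) \<le> sqrt (v\<^sup>2 + \<tau>\<^sup>2) + \<bar>u - v\<bar>"
    using real_sqrt_sum_squares_triangle_ineq[of v "u - v" \<tau> 0] by simp
  moreover have "u + \<bar>u - v\<bar> \<le> v + 2 * c" using assms by (simp add: abs_le_iff abs_if)
  ultimately have "u + sqrt (u\<^sup>2 + \<tau>\<^sup>2) \<le> v + sqrt (v\<^sup>2 + \<tau>\<^sup>2) + 2 * c" by linarith
  then show ?thesis by (simp add: smooth_plus_def field_simps)
qed

section \<open>The quadratic majorant of the smoothed objective\<close>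

lemma bounded_linear_x_part: "bounded_linear (x_part :: ('n::finite) point \<Rightarrow> _)"
proof -
  have "linear (x_part :: 'n point \<Rightarrow> _)" by (rule linearI) (simp_all add: x_part_def vec_eq_iff)
  then show ?thesis by (rule linear_conv_bounded_linear[THEN iffD1])
qed

lemma bounded_linear_t_part: "bounded_linear (t_part :: ('n::finite) point \<Rightarrow> _)"
  unfolding t_part_def by (rule bounded_linear_vec_nth)

lemma J_matrix_mult:
  "(J_matrix f z *v p) $ i = gradient (f i) (x_part z) \<bullet> x_part p - t_part p"
  by (simp add: J_matrix_def matrix_vector_mult_def UNIV_option_conv sum.reindex
      x_part_def t_part_def inner_vec_def)

lemma omega_pos: "\<tau> > 0 \<Longrightarrow> omega f \<tau> z i > 0"
  by (simp add: omega_def add_nonneg_pos)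

text \<open>
  All later facts about the metric are read off this bilinear form: its symmetry and positivity can be
  checked summand by summand.
\<close>

lemma P_matrix_form:
  "v \<bullet> (P_matrix f L \<tau> \<delta> z *v w) =
     \<delta> * (v \<bullet> w) + (\<Sum>i\<in>UNIV. L i) * (x_part v \<bullet> x_part w)
       + (\<Sum>i\<in>UNIV. (J_matrix f z *v v) $ i * (J_matrix f z *v w) $ i / (2 * omega f \<tau> z i))"
proof -
  have x: "v \<bullet> (Pi_x *v w) = x_part v \<bullet> x_part w"
    by (simp add: Pi_x_def diag_matrix_def matrix_vector_mult_def inner_vec_def if_distrib if_distribR
      sum.delta UNIV_option_conv sum.reindex x_part_def cong: if_cong)
  have D: "D_matrix f \<tau> z *v y = (\<chi> i. y $ i / omega f \<tau> z i)" for y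
    by (simp add: D_matrix_def diag_matrix_def matrix_vector_mult_def if_distrib if_distribR
       vec_eq_iff divide_inverse mult.commute cong: if_cong)
  have "v \<bullet> ((transpose (J_matrix f z) ** D_matrix f \<tau> z ** J_matrix f z) *v w)
      = (J_matrix f z *v v) \<bullet> (D_matrix f \<tau> z *v (J_matrix f z *v w))"
    by (metis dot_lmul_matrix matrix_vector_mul_assoc transpose_matrix_vector transpose_transpose)
  also have "\<dots> = (\<Sum>i\<in>UNIV. (J_matrix f z *v v) $ i * (J_matrix f z *v w) $ i / omega f \<tau> z i)"
    by (simp add: D inner_vec_def)
  finally have J: "v \<bullet> ((transpose (J_matrix f z) ** D_matrix f \<tau> z ** J_matrix f z) *v w) = \<dots>" .
  show ?thesis
    by (simp add: P_matrix_def matrix_vector_mult_add_rdistrib inner_add_right x J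
       scaleR_matrix_vector_assoc[symmetric] sum_distrib_left)
qed

lemma has_derivative_Phi:
  assumes diff: "\<And>i x. f i differentiable (at x)" and \<tau>: "\<tau> > 0"
  shows "(Phi f \<tau> has_derivative (\<lambda>p. t_part p +
     (\<Sum>i\<in>UNIV. (1 + (f i (x_part z) - t_part z) / omega f \<tau> z i) / 2 * (J_matrix f z *v p) $ i)))
     (at z)"
proof -
  note x = bounded_linear.has_derivative[OF bounded_linear_x_part has_derivative_ident]
  note t = bounded_linear.has_derivative[OF bounded_linear_t_part has_derivative_ident]
  have r: "((\<lambda>z. f i (x_part z) - t_part z) has_derivative (\<lambda>p. (J_matrix f z *v p) $ i)) (at z)"
    for i
    unfolding J_matrix_mult inner_commute[of "gradient _ _"]
    by (intro has_derivative_diff t has_derivative_compose[OF x has_derivative_gradient[OF diff]])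
  have "((\<lambda>z. smooth_plus \<tau> (f i (x_part z) - t_part z)) has_derivative
      (\<lambda>p. (1 + (f i (x_part z) - t_part z) / omega f \<tau> z i) / 2 * (J_matrix f z *v p) $ i)) (at z)"
    for i
    using has_derivative_compose[OF r, OF has_real_derivative_smooth_plus[OF \<tau>,
        unfolded has_field_derivative_def]]
    by (simp add: omega_def)
  then show ?thesis unfolding Phi_def[abs_def]
    by (intro has_derivative_add t has_derivative_sum)
qed

text \<open>
  The metric \<open>P\<^sub>k\<close> is built so that this holds. In each summand the descent lemma replaces \<open>f\<^sub>i\<close> by its
  linearization plus \<open>L\<^sub>i / 2\<close> times the squared \<open>x\<close>-displacement; the latter comes out of the smoothed plus
  function at unit cost, and the former goes into the parabola above. Summing gives exactly the quadratic form of
  \<open>\<Sum>L\<^sub>i \<Pi>\<^sub>x + J\<^sup>T D J / 2\<close>.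
\<close>

lemma Phi_majorant:
  assumes diff: "\<And>i x. f i differentiable (at x)"
    and lip: "\<And>i. (L i)-lipschitz_on UNIV (gradient (f i))" and \<tau>: "\<tau> > 0" and \<delta>: "\<delta> > 0"
  shows "Phi f \<tau> (z + p) \<le> Phi f \<tau> z + gradient (Phi f \<tau>) z \<bullet> p
    + 1 / 2 * (p \<bullet> (P_matrix f L \<tau> \<delta> z *v p))"
proof -
  define r where "r i = f i (x_part z) - t_part z" for i
  define J where "J i = (J_matrix f z *v p) $ i" for i
  define X where "X = x_part p \<bullet> x_part p"
  have L: "0 \<le> L i" for i using lip[of i] by (simp add: lipschitz_on_def)
  have xt: "x_part (z + p) = x_part z + x_part p" "t_part (z + p) = t_part z + t_part p"
    by (simp_all add: linear_add bounded_linear.linear bounded_linear_x_part bounded_linear_t_part)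
  have one: "smooth_plus \<tau> (f i (x_part (z + p)) - t_part (z + p))
      \<le> smooth_plus \<tau> (r i) + (1 + r i / omega f \<tau> z i) / 2 * J i
        + (J i * J i / (2 * omega f \<tau> z i)) / 2 + L i / 2 * X" for i
  proof -
    have "f i (x_part (z + p)) - t_part (z + p) \<le> (r i + J i) + L i / 2 * X"
      using descent_lemma[OF diff lip, of i "x_part z" "x_part p"]
      by (simp add: xt r_def J_def X_def J_matrix_mult)
    then have "smooth_plus \<tau> (f i (x_part (z + p)) - t_part (z + p))
        \<le> smooth_plus \<tau> (r i + J i) + L i / 2 * X"
      by (rule smooth_plus_add_le[OF \<tau>]) (simp add: L X_def)
    also have "smooth_plus \<tau> (r i + J i) \<le> smooth_plus \<tau> (r i) + (1 + r i / omega f \<tau> z i) / 2 * J i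
        + (J i)\<^sup>2 / (4 * omega f \<tau> z i)"
      using smooth_plus_quadratic_bound[OF \<tau>, of "r i" "J i"] by (simp add: omega_def r_def)
    finally show ?thesis by (simp add: power2_eq_square)
  qed
  have "Phi f \<tau> (z + p) \<le> t_part z + t_part p + (\<Sum>i\<in>UNIV. smooth_plus \<tau> (r i)
      + (1 + r i / omega f \<tau> z i) / 2 * J i + (J i * J i / (2 * omega f \<tau> z i)) / 2 + L i / 2 * X)"
    unfolding Phi_def using one by (intro add_mono sum_mono) (simp_all add: xt)
  also have "\<dots> = Phi f \<tau> z + (t_part p + (\<Sum>i\<in>UNIV. (1 + r i / omega f \<tau> z i) / 2 * J i))
      + 1 / 2 * (sum L UNIV * X + (\<Sum>i\<in>UNIV. J i * J i / (2 * omega f \<tau> z i)))"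
    by (simp add: Phi_def r_def sum.distrib sum_divide_distrib[symmetric] sum_distrib_right
        add_divide_distrib distrib_left)
  also have "t_part p + (\<Sum>i\<in>UNIV. (1 + r i / omega f \<tau> z i) / 2 * J i) = gradient (Phi f \<tau>) z \<bullet> p"
    unfolding gradient_inner_eq[OF has_derivative_Phi[OF diff \<tau>]] r_def J_def ..
  also have "sum L UNIV * X + (\<Sum>i\<in>UNIV. J i * J i / (2 * omega f \<tau> z i))
      \<le> p \<bullet> (P_matrix f L \<tau> \<delta> z *v p)"
    using \<delta> by (simp add: P_matrix_form X_def J_def)
  finally show ?thesis by simp
qed

section \<open>Positive definite metrics\<close>

definition pos_def :: "real ^ 'k ^ ('k::finite) \<Rightarrow> bool" where
  "pos_def A \<longleftrightarrow> transpose A = A \<and> (\<forall>v. v \<noteq> 0 \<longrightarrow> 0 < v \<bullet> (A *v v))"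

lemma symmetric_matrix_inner_commute:
  fixes A :: "real ^ 'k ^ ('k::finite)"
  assumes "transpose A = A"
  shows "v \<bullet> (A *v w) = w \<bullet> (A *v v)"
  by (metis assms dot_lmul_matrix inner_commute transpose_matrix_vector)

lemma pos_def_imp_pos_semidef: "pos_def A \<Longrightarrow> pos_semidef A"
  unfolding pos_def_def pos_semidef_def
  by (metis inner_zero_left less_eq_real_def)

text \<open>
  The quadratic \<open>y \<mapsto> (v + y w)\<^sup>T A (v + y w)\<close> is nonnegative; evaluate it at its minimizer, or, if its
  leading coefficient vanishes, at a point where a nonzero linear term would make it negative.
\<close>

lemma pos_semidef_Cauchy_Schwarz:
  assumes "pos_semidef A"
  shows "(v \<bullet> (A *v w))\<^sup>2 \<le> (v \<bullet> (A *v v)) * (w \<bullet> (A *v w))"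
proof -
  let ?a = "v \<bullet> (A *v v)" and ?b = "v \<bullet> (A *v w)" and ?c = "w \<bullet> (A *v w)"
  have sym: "w \<bullet> (A *v v) = ?b"
    using assms by (simp add: pos_semidef_def symmetric_matrix_inner_commute)
  have nonneg: "0 \<le> x \<bullet> (A *v x)" for x using assms by (simp add: pos_semidef_def)
  have form: "0 \<le> ?a + 2 * y * ?b + y\<^sup>2 * ?c" for y
    using nonneg[of "v + y *\<^sub>R w"]
    by (simp add: sym inner_add_left inner_add_right matrix_vector_right_distrib
        matrix_vector_mult_scaleR power2_eq_square algebra_simps)
  show ?thesis
  proof (cases "?c = 0")
    case False
    then have "?c > 0" using nonneg[of w] by simp
    then show ?thesis using form[of "- ?b / ?c"] by (simp add: field_simps power2_eq_square)
  next
    case True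
    have "?b = 0"
    proof (rule ccontr)
      assume "?b \<noteq> 0"
      then show False using form[of "- (?a + 1) / (2 * ?b)"] True by (simp add: field_simps)
    qed
    then show ?thesis using True by simp
  qed
qed

text \<open>
  Bessel's inequality for the plane spanned by two unit vectors that need not be orthogonal, cleared of
  the denominator \<open>1 - c\<^sup>2\<close> so that it stays meaningful when they are parallel. It is Cauchy-Schwarz for
  the components of \<open>u\<close> and \<open>h\<close> orthogonal to \<open>e\<close>.
\<close>

lemma pos_semidef_Bessel_pair:
  fixes u :: "real ^ 'k::finite"
  assumes ps: "pos_semidef P"
    and e: "e \<bullet> (P *v e) = 1" and h: "h \<bullet> (P *v h) = 1"
  defines "c \<equiv> e \<bullet> (P *v h)" and "p \<equiv> u \<bullet> (P *v e)"
  shows "(u \<bullet> (P *v h) - c * p)\<^sup>2 \<le> (u \<bullet> (P *v u) - p\<^sup>2) * (1 - c\<^sup>2)"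
proof -
  have sym: "v \<bullet> (P *v w) = w \<bullet> (P *v v)" for v w
    using ps by (simp add: pos_semidef_def symmetric_matrix_inner_commute)
  note bil = inner_diff_left inner_diff_right matrix_vector_mult_diff_distrib
    matrix_vector_mult_scaleR
  define n where "n = h - c *\<^sub>R e"
  define v where "v = u - p *\<^sub>R e"
  have [simp]: "e \<bullet> (P *v u) = p" "h \<bullet> (P *v e) = c" "u \<bullet> (P *v e) = p" "e \<bullet> (P *v h) = c"
    "h \<bullet> (P *v u) = u \<bullet> (P *v h)"
    by (simp_all add: p_def c_def sym)
  have "v \<bullet> (P *v n) = u \<bullet> (P *v h) - c * p" "v \<bullet> (P *v v) = u \<bullet> (P *v u) - p\<^sup>2"
    "n \<bullet> (P *v n) = 1 - c\<^sup>2"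
    by (simp_all add: v_def n_def bil e h algebra_simps power2_eq_square)
  then show ?thesis using pos_semidef_Cauchy_Schwarz[OF ps, of v n] by simp
qed

lemma pos_def_mult_inverse:
  assumes "pos_def A"
  shows "A *v (matrix_inv A *v x) = x"
proof -
  have "\<forall>v. A *v v = 0 \<longrightarrow> v = 0"
    using assms by (metis inner_zero_right less_irrefl pos_def_def)
  then have "invertible A"
    by (simp add: invertible_left_inverse matrix_left_invertible_ker)
  then have "A ** matrix_inv A = mat 1"
    unfolding invertible_def matrix_inv_def by (metis (mono_tags, lifting) someI_ex)
  then show ?thesis by (simp add: matrix_vector_mul_assoc)
qed

text \<open>
  An upper bound on \<open>P\<close> is a lower bound on its inverse. Taking \<open>u = P\<^sup>-\<^sup>1 g\<close>, the Cauchy-Schwarz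
  inequality for \<open>g\<^sup>T P u = \<parallel>g\<parallel>\<^sup>2\<close> avoids square roots and eigenvalues of \<open>P\<close>.
\<close>

lemma norm_le_inverse_form:
  assumes pd: "pos_def P" and le: "P \<preceq>\<^sub>L M *\<^sub>R mat 1"
  shows "(norm g)\<^sup>2 \<le> M * (g \<bullet> (matrix_inv P *v g))"
proof (cases "g = 0")
  case False
  define u where "u = matrix_inv P *v g"
  have Pu: "P *v u = g" by (simp add: u_def pos_def_mult_inverse[OF pd])
  have "0 \<le> g \<bullet> ((M *\<^sub>R mat 1 - P) *v g)"
    using le by (simp add: loewner_le_def pos_semidef_def)
  then have PM: "g \<bullet> (P *v g) \<le> M * (norm g)\<^sup>2"
    by (simp add: matrix_vector_mult_diff_rdistrib inner_diff_right dot_square_norm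
        scaleR_matrix_vector_assoc[symmetric])
  have sym: "g \<bullet> (P *v u) = u \<bullet> (P *v g)"
    using pd by (simp add: pos_def_def symmetric_matrix_inner_commute)
  have pos: "0 \<le> g \<bullet> u"
    using pos_def_imp_pos_semidef[OF pd] Pu by (metis inner_commute pos_semidef_def)
  have "((norm g)\<^sup>2)\<^sup>2 = (g \<bullet> (P *v u))\<^sup>2" by (simp add: Pu dot_square_norm)
  also have "\<dots> \<le> (g \<bullet> (P *v g)) * (u \<bullet> (P *v u))"
    by (rule pos_semidef_Cauchy_Schwarz[OF pos_def_imp_pos_semidef[OF pd]])
  also have "\<dots> \<le> (M * (norm g)\<^sup>2) * (g \<bullet> u)"
    using PM pos by (simp add: Pu inner_commute mult_right_mono)
  finally have "(norm g)\<^sup>2 * (norm g)\<^sup>2 \<le> (norm g)\<^sup>2 * (M * (g \<bullet> u))"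
    by (simp add: power2_eq_square mult_ac)
  then show ?thesis
    using False mult_le_cancel_left_pos[of "(norm g)\<^sup>2"] by (metis u_def zero_less_norm_iff zero_less_power)
qed simp

text \<open>
  This uses that the space has positive dimension, which is automatic for vectors indexed by a type.
\<close>

lemma loewner_bound_pos:
  fixes P :: "real ^ 'k ^ ('k::finite)"
  assumes "pos_def P" and le: "P \<preceq>\<^sub>L M *\<^sub>R mat 1"
  shows "M > 0"
proof -
  define v where "v = (axis undefined 1 :: real ^ 'k)"
  have v: "v \<noteq> 0" by (simp add: v_def axis_eq_0_iff)
  have "0 < v \<bullet> (P *v v)" using assms v by (simp add: pos_def_def)
  moreover have "0 \<le> v \<bullet> ((M *\<^sub>R mat 1 - P) *v v)"
    using le by (simp add: loewner_le_def pos_semidef_def)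
  then have "v \<bullet> (P *v v) \<le> M * (v \<bullet> v)"
    by (simp add: matrix_vector_mult_diff_rdistrib inner_diff_right
        scaleR_matrix_vector_assoc[symmetric])
  ultimately have "0 < M * (v \<bullet> v)" by linarith
  then show ?thesis using v by (metis inner_gt_zero_iff zero_less_mult_pos2)
qed

lemma pos_def_P_matrix:
  assumes "\<tau> > 0" "\<delta> > 0" "\<And>i. 0 \<le> L i"
  shows "pos_def (P_matrix f L \<tau> \<delta> z)"
proof -
  let ?P = "P_matrix f L \<tau> \<delta> z"
  have "(transpose ?P *v w) \<bullet> v = (?P *v w) \<bullet> v" for v w
  proof -
    have "(transpose ?P *v w) \<bullet> v = w \<bullet> (?P *v v)"
      by (simp only: transpose_matrix_vector dot_lmul_matrix)
    also have "\<dots> = v \<bullet> (?P *v w)" by (simp add: P_matrix_form mult.commute inner_commute)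
    finally show ?thesis by (simp add: inner_commute)
  qed
  then have "transpose ?P = ?P" by (metis matrix_eq vector_eq_rdot)
  moreover have "0 < v \<bullet> (?P *v v)" if "v \<noteq> 0" for v
    unfolding P_matrix_form using assms that
    by (intro add_pos_nonneg mult_pos_pos sum_nonneg divide_nonneg_pos zero_le_square)
       (auto simp: omega_pos sum_nonneg)
  ultimately show ?thesis by (simp add: pos_def_def)
qed

section \<open>The two search directions\<close>

text \<open>
  Here \<open>p\<close> and \<open>y\<close> are the components of the preconditioned gradient in the plane on which the direction
  is corrected, \<open>\<omega>\<close> is the scale of the quarter turn and \<open>U\<close> the full squared length; the left side is the squared
  length of the direction. The difference of the two sides is at least the binary quadratic form with
  diagonal \<open>A\<close>, \<open>E\<close> and off-diagonal entry \<open>\<mu> \<omega>\<close>. Its determinant factors as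
  \<open>(E - \<mu>) (E + (\<Gamma> - 1) \<mu>)\<close>, which is nonnegative for \<open>0 \<le> \<mu> \<le> E\<close>.
\<close>

lemma rotated_plane_bound:
  fixes p y U \<omega> \<mu> \<Gamma> :: real
  assumes U: "p\<^sup>2 + y\<^sup>2 \<le> U" and \<Gamma>: "1 \<le> \<Gamma>" and \<mu>: "0 \<le> \<mu>" "\<mu> \<le> \<Gamma> - 1 - \<omega>\<^sup>2"
  shows "U + 2 * \<mu> * p\<^sup>2 + \<mu>\<^sup>2 * p\<^sup>2 + \<omega>\<^sup>2 * (p\<^sup>2 + y\<^sup>2) - 2 * \<mu> * \<omega> * p * y
    \<le> \<Gamma> * (U + \<mu> * p\<^sup>2)"
proof -
  define E where "E = \<Gamma> - 1 - \<omega>\<^sup>2"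
  define A where "A = E + \<mu> * (\<Gamma> - 2 - \<mu>)"
  have E: "\<mu> \<le> E" "E \<le> \<Gamma> - 1" using \<mu> by (simp_all add: E_def)
  have det: "A * E - (\<mu> * \<omega>)\<^sup>2 = (E - \<mu>) * (E + (\<Gamma> - 1) * \<mu>)"
  proof -
    have w: "\<omega>\<^sup>2 = \<Gamma> - 1 - E" by (simp add: E_def)
    show ?thesis unfolding power_mult_distrib w A_def
      by (simp add: algebra_simps power2_eq_square)
  qed
  have nonneg: "0 \<le> A * p\<^sup>2 + 2 * (\<mu> * \<omega>) * p * y + E * y\<^sup>2"
  proof (cases "E = 0")
    case True
    then have "\<mu> = 0" using \<mu> E by simp
    then show ?thesis using True by (simp add: A_def)
  next
    case False
    then have Epos: "E > 0" using E \<mu> by simp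
    have "0 \<le> (E - \<mu>) * (E + (\<Gamma> - 1) * \<mu>)"
      using E \<mu> \<Gamma> by (intro mult_nonneg_nonneg add_nonneg_nonneg) auto
    then have "0 \<le> (A * E - (\<mu> * \<omega>)\<^sup>2) * p\<^sup>2 + (\<mu> * \<omega> * p + E * y)\<^sup>2"
      unfolding det by simp
    also have "\<dots> = E * (A * p\<^sup>2 + 2 * (\<mu> * \<omega>) * p * y + E * y\<^sup>2)"
      by (simp add: algebra_simps power2_eq_square)
    finally show ?thesis using Epos by (simp add: zero_le_mult_iff)
  qed
  have "(\<Gamma> - 1) * (p\<^sup>2 + y\<^sup>2) \<le> (\<Gamma> - 1) * U"
    using U \<Gamma> by (intro mult_left_mono) auto
  then show ?thesis using nonneg unfolding A_def E_def
    by (simp add: algebra_simps power2_eq_square)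
qed

text \<open>
  In the inner product of \<open>P\<close>, the direction is \<open>- u + S u - \<mu> \<langle>u, e\<rangle> e\<close>, where
  \<open>u = P\<^sup>-\<^sup>1 g\<close>, \<open>e\<close> and \<open>h\<close> are the normalized vectors \<open>s\<close> and \<open>P\<^sup>-\<^sup>1 b\<close>, and
  \<open>S u = (\<langle>u, h\<rangle> e - \<langle>u, e\<rangle> h) / (\<theta> + c)\<close> is skew. Being skew, \<open>S\<close> drops out of \<open>g \<bullet> d\<close>, so
  descent is never worse than for the restart direction; and \<open>S\<close> acts on the plane of \<open>e\<close> and \<open>h\<close> as
  \<open>\<varpi>\<close> times a quarter turn, so the length of \<open>d\<close> is governed by the planar bound.
\<close>

lemma nonrestart_direction_bounds:
  fixes g :: "real ^ 'k::finite"
  assumes pd: "pos_def P" and \<theta>: "\<theta> > 1" and s: "s \<noteq> 0" and b: "b \<noteq> 0"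
    and \<mu>: "0 \<le> \<mu>" "\<mu> \<le> mu_star \<theta> P s b"
  defines "d \<equiv> nonrestart_direction \<theta> P g s b \<mu>"
  shows "d \<bullet> (P *v d) \<le> Gamma0 \<theta> * - (g \<bullet> d)"
    and "g \<bullet> (matrix_inv P *v g) \<le> - (g \<bullet> d)"
proof -
  have ps: "pos_semidef P" by (rule pos_def_imp_pos_semidef[OF pd])
  have sym: "v \<bullet> (P *v x) = x \<bullet> (P *v v)" for v x
    using pd by (simp add: pos_def_def symmetric_matrix_inner_commute)
  define u where "u = matrix_inv P *v g"
  define w where "w = matrix_inv P *v b"
  have Pu: "P *v u = g" and Pw: "P *v w = b"
    by (simp_all add: u_def w_def pos_def_mult_inverse[OF pd])
  define C where "C = s \<bullet> (P *v s)"
  define B where "B = b \<bullet> w"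
  have C: "C > 0" using pd s by (simp add: C_def pos_def_def)
  have "w \<noteq> 0" using Pw b by auto
  then have B: "B > 0" using pd Pw by (metis B_def inner_commute pos_def_def)
  have root: "CB_root P s b = sqrt C * sqrt B"
    by (simp add: CB_root_def C_def B_def w_def real_sqrt_mult)
  define e where "e = (1 / sqrt C) *\<^sub>R s"
  define h where "h = (1 / sqrt B) *\<^sub>R w"
  have ee: "e \<bullet> (P *v e) = 1" using C
    by (simp add: e_def matrix_vector_mult_scaleR C_def[symmetric] flip: real_sqrt_mult)
  have hh: "h \<bullet> (P *v h) = 1" using B
    by (simp add: h_def matrix_vector_mult_scaleR Pw inner_commute[of w] B_def[symmetric]
        flip: real_sqrt_mult)
  define c where "c = chi_cos P s b"
  have eh: "e \<bullet> (P *v h) = c"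
    by (simp add: e_def h_def c_def chi_cos_def root matrix_vector_mult_scaleR Pw)
  have "c\<^sup>2 \<le> 1"
    using pos_semidef_Cauchy_Schwarz[OF ps, of e h] by (simp add: ee hh eh)
  then have \<sigma>: "0 \<le> 1 - c\<^sup>2" and "- 1 \<le> c" by (auto simp: abs_square_le_1 abs_le_iff)
  then have \<theta>c: "\<theta> + c > 0" using \<theta> by simp
  define \<kappa> where "\<kappa> = 1 / (\<theta> + c)"
  define p where "p = u \<bullet> (P *v e)"
  define r where "r = u \<bullet> (P *v h)"
  have p: "p = (g \<bullet> s) / sqrt C"
    by (simp add: p_def sym[of u] Pu) (simp add: e_def inner_commute)
  have r: "r = (g \<bullet> w) / sqrt B"
    by (simp add: r_def sym[of u] Pu) (simp add: h_def inner_commute)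
  \<comment> \<open>In the metric \<open>P\<close> the correction is a scaled quarter turn of the plane of \<open>e\<close> and \<open>h\<close>,
     plus a damping along \<open>e\<close>.\<close>
  have D: "D_scalar \<theta> P s b = sqrt C * sqrt B * (\<theta> + c)"
    using C B by (simp add: D_scalar_def c_def chi_cos_def root field_simps)
  have d: "d = - u + (\<kappa> * r - \<mu> * p) *\<^sub>R e - (\<kappa> * p) *\<^sub>R h"
  proof -
    have 1: "(g \<bullet> w) / D_scalar \<theta> P s b - \<mu> * ((g \<bullet> s) / C) = (\<kappa> * r - \<mu> * p) / sqrt C"
    proof -
      have "(g \<bullet> w) / D_scalar \<theta> P s b = \<kappa> * r / sqrt C"
        using C B \<theta>c by (simp add: D \<kappa>_def r field_simps)
      moreover have "(g \<bullet> s) / C = p / sqrt C"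
        using C by (simp add: p)
      ultimately show ?thesis by (simp add: diff_divide_distrib)
    qed
    have 2: "(g \<bullet> s) / D_scalar \<theta> P s b = \<kappa> * p / sqrt B"
      using C B \<theta>c by (simp add: D \<kappa>_def p field_simps)
    show ?thesis
      unfolding d_def nonrestart_direction_def u_def[symmetric] w_def[symmetric] C_def[symmetric] 1 2
      by (simp add: e_def h_def)
  qed
  define U where "U = u \<bullet> (P *v u)"
  note bil = inner_add_left inner_add_right inner_diff_left inner_diff_right
    matrix_vector_mult_diff_distrib matrix_vector_right_distrib matrix_vector_mult_scaleR
  have [simp]: "u \<bullet> (P *v e) = p" "u \<bullet> (P *v h) = r" "e \<bullet> (P *v u) = p" "h \<bullet> (P *v u) = r"
    "e \<bullet> (P *v h) = c" "h \<bullet> (P *v e) = c" "e \<bullet> (P *v e) = 1" "h \<bullet> (P *v h) = 1"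
    "u \<bullet> (P *v u) = U"
    using eh ee hh by (simp_all add: p_def r_def U_def sym)
  have neg: "P *v (- u) = - (P *v u)"
    using matrix_vector_mult_scaleR[of P "-1" u] by simp
  have gd: "- (g \<bullet> d) = U + \<mu> * p\<^sup>2"
  proof -
    have "g \<bullet> d = u \<bullet> (P *v d)" by (simp add: sym[of u] Pu inner_commute)
    then show ?thesis by (simp add: d bil neg algebra_simps power2_eq_square)
  qed
  define t where "t = r - c * p"
  define \<omega> where "\<omega> = \<kappa> * sqrt (1 - c\<^sup>2)"
  define y where "y = t / sqrt (1 - c\<^sup>2)"
  have t: "t\<^sup>2 \<le> (U - p\<^sup>2) * (1 - c\<^sup>2)"
    using pos_semidef_Bessel_pair[OF ps ee hh, of u] by (simp add: t_def)
  \<comment> \<open>If \<open>e\<close> and \<open>h\<close> are parallel then \<open>t = 0\<close>, and the default value \<open>y = 0\<close> is the right one.\<close>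
  have ty: "t = sqrt (1 - c\<^sup>2) * y" using t by (cases "1 - c\<^sup>2 = 0") (auto simp: y_def)
  have "p\<^sup>2 \<le> U"
    using pos_semidef_Cauchy_Schwarz[OF ps, of u e] by simp
  then have U: "p\<^sup>2 + y\<^sup>2 \<le> U"
    using t \<sigma> by (cases "1 - c\<^sup>2 = 0") (auto simp: y_def power_divide field_simps)
  have dPd: "d \<bullet> (P *v d)
      = U + 2 * \<mu> * p\<^sup>2 + \<mu>\<^sup>2 * p\<^sup>2 + \<omega>\<^sup>2 * (p\<^sup>2 + y\<^sup>2) - 2 * \<mu> * \<omega> * p * y"
  proof -
    have w: "\<omega>\<^sup>2 = \<kappa>\<^sup>2 * (1 - c\<^sup>2)" using \<sigma> by (simp add: \<omega>_def power_mult_distrib)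
    have wy: "\<omega> * y = \<kappa> * t" by (simp add: \<omega>_def ty)
    have "\<omega>\<^sup>2 * y\<^sup>2 = \<kappa>\<^sup>2 * t\<^sup>2" using wy by (metis power_mult_distrib)
    then have "\<omega>\<^sup>2 * (p\<^sup>2 + y\<^sup>2) = \<kappa>\<^sup>2 * (1 - c\<^sup>2) * p\<^sup>2 + \<kappa>\<^sup>2 * t\<^sup>2"
      unfolding distrib_left w by simp
    moreover have "2 * \<mu> * \<omega> * p * y = 2 * \<mu> * p * (\<kappa> * t)" by (simp flip: wy)
    moreover have "d \<bullet> (P *v d)
      = U + 2 * \<mu> * p\<^sup>2 + \<mu>\<^sup>2 * p\<^sup>2 + (\<kappa>\<^sup>2 * (1 - c\<^sup>2) * p\<^sup>2 + \<kappa>\<^sup>2 * t\<^sup>2) - 2 * \<mu> * p * (\<kappa> * t)"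
      by (simp add: d bil neg t_def algebra_simps power2_eq_square)
    ultimately show ?thesis by linarith
  qed
  have \<Gamma>: "1 \<le> Gamma0 \<theta>"
    using \<theta> by (simp add: Gamma0_def divide_simps power_strict_increasing one_less_power)
  have "\<mu> * (sqrt (Gamma0 \<theta>) + 1) \<le> Gamma0 \<theta> - 1 - varpi_sq \<theta> P s b"
    using \<mu>(2) \<Gamma> by (simp add: mu_star_def pos_le_divide_eq add_nonneg_pos)
  moreover have "\<mu> * 1 \<le> \<mu> * (sqrt (Gamma0 \<theta>) + 1)"
    using \<mu>(1) \<Gamma> by (intro mult_left_mono) auto
  moreover have "varpi_sq \<theta> P s b = \<omega>\<^sup>2"
    using \<sigma> by (simp add: varpi_sq_def c_def[symmetric] \<omega>_def \<kappa>_def power_mult_distrib power_divide)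
  ultimately have "\<mu> \<le> Gamma0 \<theta> - 1 - \<omega>\<^sup>2" by linarith
  from rotated_plane_bound[OF U \<Gamma> \<mu>(1) this]
  show "d \<bullet> (P *v d) \<le> Gamma0 \<theta> * - (g \<bullet> d)" by (simp only: dPd gd)
  have "g \<bullet> (matrix_inv P *v g) = U"
    by (simp add: U_def Pu inner_commute[of g] flip: u_def)
  then show "g \<bullet> (matrix_inv P *v g) \<le> - (g \<bullet> d)" using \<mu>(1) by (simp add: gd)
qed

lemma restart_direction_form:
  fixes g :: "real ^ 'k::finite"
  assumes pd: "pos_def P"
  defines "d \<equiv> restart_direction P g"
  shows "- (g \<bullet> d) = g \<bullet> (matrix_inv P *v g)" and "d \<bullet> (P *v d) = - (g \<bullet> d)"
proof -
  have "P *v (- x) = - (P *v x)" for x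
    using matrix_vector_mult_scaleR[of P "-1" x] by simp
  then show "- (g \<bullet> d) = g \<bullet> (matrix_inv P *v g)" "d \<bullet> (P *v d) = - (g \<bullet> d)"
    by (simp_all add: d_def restart_direction_def pos_def_mult_inverse[OF pd] inner_commute)
qed

section \<open>Backtracking under a quadratic majorant\<close>

text \<open>
  A trial step \<open>a \<le> 2 (1 - c1) \<kappa>\<close> passes, since the quadratic term of the majorant then takes away at most
  the fraction \<open>1 - c1\<close> of the predicted decrease. The accepted step is either the first trial or \<open>\<rho>\<close>
  times a rejected one. The same fact shows that some trial passes, so that the least index is meaningful.
\<close>

lemma armijo_step_bounds:
  assumes maj: "\<And>\<alpha>. F (z + \<alpha> *\<^sub>R d) \<le> F z + \<alpha> * (g \<bullet> d) + \<alpha>\<^sup>2 / 2 * q"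
    and q: "\<kappa> * q \<le> - (g \<bullet> d)" and \<kappa>: "0 < \<kappa>" and desc: "g \<bullet> d \<le> 0"
    and c1: "0 < c1" "c1 < 1" and \<rho>: "0 < \<rho>" "\<rho> < 1"
  defines "\<alpha> \<equiv> armijo_step F c1 \<rho> z g d"
  shows "F (z + \<alpha> *\<^sub>R d) \<le> F z + c1 * \<alpha> * (g \<bullet> d)"
    and "\<rho> * min 1 (2 * (1 - c1) * \<kappa>) \<le> \<alpha>"
proof -
  let ?ok = "\<lambda>j. F (z + (\<rho> ^ j) *\<^sub>R d) \<le> F z + c1 * \<rho> ^ j * (g \<bullet> d)"
  have ok: "?ok j" if "\<rho> ^ j \<le> 2 * (1 - c1) * \<kappa>" for j
  proof -
    define a where "a = \<rho> ^ j"
    have a: "0 < a" "a \<le> 2 * (1 - c1) * \<kappa>" using \<rho> that by (simp_all add: a_def)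
    have "q \<le> - (g \<bullet> d) / \<kappa>" using q \<kappa> by (simp add: field_simps)
    then have "a / 2 * q \<le> a / 2 * (- (g \<bullet> d) / \<kappa>)" using a by (intro mult_left_mono) auto
    also have "\<dots> = a / (2 * \<kappa>) * - (g \<bullet> d)" by simp
    also have "\<dots> \<le> (1 - c1) * - (g \<bullet> d)"
      using a \<kappa> desc by (intro mult_right_mono) (auto simp: field_simps)
    finally have "a * (a / 2 * q) \<le> a * ((1 - c1) * - (g \<bullet> d))"
      using a by (intro mult_left_mono) auto
    then show ?thesis using maj[of a] unfolding a_def[symmetric]
      by (simp add: algebra_simps power2_eq_square)
  qed
  have \<alpha>: "\<alpha> = \<rho> ^ (LEAST j. ?ok j)" by (simp add: \<alpha>_def armijo_step_def)
  obtain j where "\<rho> ^ j < 2 * (1 - c1) * \<kappa>"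
    using real_arch_pow_inv[of "2 * (1 - c1) * \<kappa>" \<rho>] \<rho> c1 \<kappa> by auto
  then have "?ok j" by (intro ok) simp
  then show "F (z + \<alpha> *\<^sub>R d) \<le> F z + c1 * \<alpha> * (g \<bullet> d)"
    unfolding \<alpha> by (rule LeastI)
  show "\<rho> * min 1 (2 * (1 - c1) * \<kappa>) \<le> \<alpha>"
  proof (cases "LEAST j. ?ok j")
    case 0
    have "\<rho> * min 1 (2 * (1 - c1) * \<kappa>) \<le> 1 * 1"
      using \<rho> c1 \<kappa> by (intro mult_mono) auto
    then show ?thesis unfolding \<alpha> 0 by simp
  next
    case (Suc i)
    have "\<not> ?ok i" by (rule not_less_Least) (simp add: Suc)
    then have "2 * (1 - c1) * \<kappa> < \<rho> ^ i" using ok[of i] by linarith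
    then have "\<rho> * min 1 (2 * (1 - c1) * \<kappa>) \<le> \<rho> * \<rho> ^ i"
      using \<rho> by (intro mult_left_mono) auto
    then show ?thesis unfolding \<alpha> Suc by simp
  qed
qed

section \<open>Decrease per iteration and the rate\<close>

lemma generated_Suc:
  "generated f \<tau> z (Suc k) \<longleftrightarrow> generated f \<tau> z k \<and> gradient (Phi f \<tau>) (z k) \<noteq> 0"
  by (auto simp: generated_def less_Suc_eq)

lemma generated_antimono: "generated f \<tau> z N \<Longrightarrow> k \<le> N \<Longrightarrow> generated f \<tau> z k"
  by (auto simp: generated_def)

text \<open>
  Both kinds of direction satisfy \<open>d\<^sup>T P d \<le> \<Gamma>\<^sub>0 (- g\<^sup>T d)\<close> with \<open>\<Gamma>\<^sub>0 = 1 / (1 - \<theta>\<^sup>-\<^sup>2)\<close>, which bounds the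
  step from below, and \<open>- g\<^sup>T d \<ge> g\<^sup>T P\<^sup>-\<^sup>1 g \<ge> \<parallel>g\<parallel>\<^sup>2 / M\<close>, which turns the decrease test into a decrease in
  terms of the gradient.
\<close>

lemma iteration_decrease:
  fixes z :: "nat \<Rightarrow> 'n::finite point"
  assumes diff: "\<And>i x. f i differentiable (at x)"
    and lip: "\<And>i. (L i)-lipschitz_on UNIV (gradient (f i))"
    and \<tau>: "\<tau> > 0" and \<delta>: "\<delta> > 0" and \<theta>: "\<theta> > 1"
    and c1: "0 < c1" "c1 < 1" and \<rho>: "0 < \<rho>" "\<rho> < 1"
    and run: "is_run f L \<tau> \<delta> \<theta> c1 \<rho> z0 z b \<mu>"
    and gen: "generated f \<tau> z (Suc k)"
    and le: "P_matrix f L \<tau> \<delta> (z k) \<preceq>\<^sub>L M *\<^sub>R mat 1"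
  shows "c1 * alpha_low \<theta> c1 \<rho> / M * (norm (gradient (Phi f \<tau>) (z k)))\<^sup>2
    \<le> Phi f \<tau> (z k) - Phi f \<tau> (z (Suc k))"
proof -
  define g where "g = gradient (Phi f \<tau>) (z k)"
  define P where "P = P_matrix f L \<tau> \<delta> (z k)"
  define s where "s = z k - z (k - 1)"
  define restart where "restart \<longleftrightarrow> k = 0 \<or> s = 0 \<or> b k = 0"
  define d where "d = (if restart then restart_direction P g
                  else nonrestart_direction \<theta> P g s (b k) (\<mu> k))"
  define \<alpha> where "\<alpha> = armijo_step (Phi f \<tau>) c1 \<rho> (z k) g d"
  define \<kappa> where "\<kappa> = 1 - inverse (\<theta>\<^sup>2)"
  have L: "0 \<le> L i" for i using lip[of i] by (simp add: lipschitz_on_def)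
  have pd: "pos_def P" unfolding P_def by (rule pos_def_P_matrix[OF \<tau> \<delta> L])
  have M: "M > 0" using loewner_bound_pos[OF pd] le by (simp add: P_def)
  have \<theta>2: "\<theta>\<^sup>2 > 1" using \<theta> by (simp add: one_less_power)
  have \<kappa>: "\<kappa> > 0" "\<kappa> \<le> 1" "\<kappa> * Gamma0 \<theta> = 1"
  proof -
    have "\<theta> \<noteq> 0" using \<theta> by simp
    then show "\<kappa> > 0" "\<kappa> \<le> 1" "\<kappa> * Gamma0 \<theta> = 1"
      using \<theta>2 by (simp_all add: \<kappa>_def Gamma0_def divide_simps inverse_less_1_iff)
  qed
  have step: "\<not> restart \<longrightarrow> 0 \<le> \<mu> k \<and> \<mu> k \<le> mu_star \<theta> P s (b k)"
    and z: "z (Suc k) = z k + \<alpha> *\<^sub>R d"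
    using run gen unfolding is_run_def Let_def generated_Suc \<alpha>_def d_def restart_def s_def P_def g_def
    by blast+
  have "\<kappa> * (d \<bullet> (P *v d)) \<le> - (g \<bullet> d) \<and> g \<bullet> (matrix_inv P *v g) \<le> - (g \<bullet> d)"
  proof (cases restart)
    case True
    note r = restart_direction_form[OF pd, of g]
    have "0 \<le> d \<bullet> (P *v d)"
      using pos_def_imp_pos_semidef[OF pd] by (simp add: pos_semidef_def)
    then have "\<kappa> * (d \<bullet> (P *v d)) \<le> 1 * (d \<bullet> (P *v d))" using \<kappa> by (intro mult_right_mono)
    then show ?thesis using r True by (simp add: d_def)
  next
    case False
    then have "s \<noteq> 0" "b k \<noteq> 0" by (simp_all add: restart_def)
    note r = nonrestart_direction_bounds[OF pd \<theta> this, of "\<mu> k" g]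
    have "d \<bullet> (P *v d) \<le> Gamma0 \<theta> * - (g \<bullet> d)" using r step False by (simp add: d_def)
    then have "\<kappa> * (d \<bullet> (P *v d)) \<le> \<kappa> * (Gamma0 \<theta> * - (g \<bullet> d))"
      using \<kappa> by (intro mult_left_mono) auto
    also have "\<dots> = (\<kappa> * Gamma0 \<theta>) * - (g \<bullet> d)" by (simp only: mult.assoc)
    finally show ?thesis using r step False by (simp add: d_def \<kappa>)
  qed
  then have q: "\<kappa> * (d \<bullet> (P *v d)) \<le> - (g \<bullet> d)" and i: "g \<bullet> (matrix_inv P *v g) \<le> - (g \<bullet> d)"
    by auto
  have "(norm g)\<^sup>2 \<le> M * (g \<bullet> (matrix_inv P *v g))"
    using norm_le_inverse_form[OF pd] le by (simp add: P_def)
  also have "\<dots> \<le> M * - (g \<bullet> d)" using i M by (intro mult_left_mono) auto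
  finally have descent: "(norm g)\<^sup>2 / M \<le> - (g \<bullet> d)" using M by (simp add: field_simps)
  moreover have "0 \<le> (norm g)\<^sup>2 / M" using M by simp
  ultimately have desc: "g \<bullet> d \<le> 0" by linarith
  have maj: "Phi f \<tau> (z k + a *\<^sub>R d) \<le> Phi f \<tau> (z k) + a * (g \<bullet> d) + a\<^sup>2 / 2 * (d \<bullet> (P *v d))" for a
    using Phi_majorant[where f = f and L = L and z = "z k" and p = "a *\<^sub>R d", OF diff lip \<tau> \<delta>]
    by (simp add: g_def P_def matrix_vector_mult_scaleR power2_eq_square)
  note armijo = armijo_step_bounds[of "Phi f \<tau>", OF maj q \<kappa>(1) desc c1 \<rho>, folded \<alpha>_def]
  have low: "alpha_low \<theta> c1 \<rho> \<le> \<alpha>" "0 \<le> alpha_low \<theta> c1 \<rho>"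
    using armijo(2) \<kappa> c1 \<rho> by (simp_all add: alpha_low_def \<kappa>_def)
  have "alpha_low \<theta> c1 \<rho> * ((norm g)\<^sup>2 / M) \<le> \<alpha> * - (g \<bullet> d)"
    using low descent M by (intro mult_mono) auto
  then have "c1 * (alpha_low \<theta> c1 \<rho> * ((norm g)\<^sup>2 / M)) \<le> c1 * (\<alpha> * - (g \<bullet> d))"
    using c1 by (intro mult_left_mono) auto
  then show ?thesis using armijo(1) by (simp add: z g_def[symmetric] mult.assoc)
qed

lemma Min_le_average:
  fixes h :: "nat \<Rightarrow> real"
  assumes "(\<Sum>k\<le>N. h k) \<le> S"
  shows "Min (h ` {0..N}) \<le> S / (real N + 1)"
proof -
  have "(\<Sum>k\<le>N. Min (h ` {0..N})) \<le> (\<Sum>k\<le>N. h k)" by (intro sum_mono) auto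
  then have "(real N + 1) * Min (h ` {0..N}) \<le> S" using assms by (simp add: add.commute)
  then show ?thesis by (simp add: field_simps)
qed

theorem corollary7p4:
  fixes f :: "'m::finite \<Rightarrow> real ^ 'n::finite \<Rightarrow> real"
    and L :: "'m \<Rightarrow> real"
    and \<tau> \<delta> \<theta> c1 \<rho> M :: real
    and z0 :: "'n point"
  assumes "\<And>i. C1_function (f i)"
    and "\<And>i. 0 \<le> L i"
    and "\<And>i. (L i)-lipschitz_on UNIV (gradient (f i))"
    and "\<tau> > 0" and "\<delta> > 0" and "\<theta> > 1"
    and "0 < c1" and "c1 < 1" and "0 < \<rho>" and "\<rho> < 1"
    and "compact (level_set f \<tau> z0)"
  shows
    "(\<forall>z b \<mu>.
        is_run f L \<tau> \<delta> \<theta> c1 \<rho> z0 z b \<mu> \<and>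
        (\<forall>k. generated f \<tau> z k \<longrightarrow> P_matrix f L \<tau> \<delta> (z k) \<preceq>\<^sub>L M *\<^sub>R mat 1) \<longrightarrow>
        (\<forall>N. generated f \<tau> z N \<longrightarrow>
           Min ((\<lambda>k. (norm (gradient (Phi f \<tau>) (z k)))\<^sup>2) ` {0..N})
             \<le> M * Phi_gap f \<tau> z0 / (c1 * alpha_low \<theta> c1 \<rho> * (real N + 1))))
     \<and>
     (\<exists>C\<ge>0. \<forall>\<epsilon>>0. \<forall>z b \<mu>.
        is_run f L \<tau> \<delta> \<theta> c1 \<rho> z0 z b \<mu> \<and>
        (\<forall>k. generated f \<tau> z k \<longrightarrow> P_matrix f L \<tau> \<delta> (z k) \<preceq>\<^sub>L M *\<^sub>R mat 1) \<longrightarrow>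
        (\<exists>k. generated f \<tau> z k \<and> real k \<le> C / \<epsilon>\<^sup>2 \<and>
             norm (gradient (Phi f \<tau>) (z k)) \<le> \<epsilon>))"
proof -
  have diff: "f i differentiable (at x)" for i x using assms(1) by (auto simp: C1_function_def)
  note step = iteration_decrease[of f L \<tau> \<delta> \<theta> c1 \<rho>, OF diff assms(3-10)]
  define A where "A = c1 * alpha_low \<theta> c1 \<rho>"
  define K where "K = M * Phi_gap f \<tau> z0 / A"
  define G where "G z k = (norm (gradient (Phi f \<tau>) (z k)))\<^sup>2" for z :: "nat \<Rightarrow> 'n point" and k
  have "inverse (\<theta>\<^sup>2) < 1" using assms(6) by (simp add: inverse_less_1_iff one_less_power)
  then have A: "A > 0" using assms by (simp add: A_def alpha_low_def)
  have "continuous_on (level_set f \<tau> z0) (Phi f \<tau>)"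
    by (meson continuous_at_imp_continuous_on has_derivative_continuous
        has_derivative_Phi[of f, OF diff assms(4)])
  then have "bdd_below (Phi f \<tau> ` level_set f \<tau> z0)"
    using assms(11) by (intro bounded_imp_bdd_below compact_imp_bounded compact_continuous_image)
  then have gap: "Phi f \<tau> z0 - Phi f \<tau> y \<le> Phi_gap f \<tau> z0" if "Phi f \<tau> y \<le> Phi f \<tau> z0" for y
    unfolding Phi_gap_def using that by (intro diff_left_mono cINF_lower) (auto simp: level_set_def)
  have rate: "Min (G z ` {0..N}) \<le> K / (real N + 1)"
    if run: "is_run f L \<tau> \<delta> \<theta> c1 \<rho> z0 z b \<mu>"
      and PM: "\<forall>k. generated f \<tau> z k \<longrightarrow> P_matrix f L \<tau> \<delta> (z k) \<preceq>\<^sub>L M *\<^sub>R mat 1"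
      and gen: "generated f \<tau> z N" for z b \<mu> N
  proof -
    have "generated f \<tau> z 0" by (simp add: generated_def)
    then have M: "M > 0"
      using PM loewner_bound_pos[OF pos_def_P_matrix[where L = L, OF assms(4,5,2)]] by blast
    have z0: "z 0 = z0" using run by (simp add: is_run_def)
    have sum: "(\<Sum>k<n. G z k) \<le> K" if n: "generated f \<tau> z n" for n
    proof -
      have dec: "A / M * G z k \<le> Phi f \<tau> (z k) - Phi f \<tau> (z (Suc k))" if "k < n" for k
      proof -
        have "generated f \<tau> z (Suc k)" using generated_antimono[OF n, of "Suc k"] that by simp
        then show ?thesis using step[OF run _ PM[rule_format]] unfolding G_def A_def
          by (simp add: generated_Suc)
      qed
      have "A / M * (\<Sum>k<n. G z k) \<le> (\<Sum>k<n. Phi f \<tau> (z k) - Phi f \<tau> (z (Suc k)))"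
        unfolding sum_distrib_left using dec by (intro sum_mono) simp
      also have "\<dots> = Phi f \<tau> z0 - Phi f \<tau> (z n)"
        using sum_lessThan_telescope'[of "\<lambda>k. Phi f \<tau> (z k)" n] by (simp add: z0)
      finally have le: "A / M * (\<Sum>k<n. G z k) \<le> Phi f \<tau> z0 - Phi f \<tau> (z n)" .
      have "0 \<le> A / M * (\<Sum>k<n. G z k)"
        using A M by (intro mult_nonneg_nonneg sum_nonneg) (auto simp: G_def)
      then have "A / M * (\<Sum>k<n. G z k) \<le> Phi_gap f \<tau> z0" using le gap[of "z n"] by linarith
      then show ?thesis using A M by (simp add: K_def field_simps)
    qed
    \<comment> \<open>If the method stops at \<open>z N\<close>, only \<open>N\<close> steps are taken, but the last gradient
       contributes nothing to the sum.\<close>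
    have "(\<Sum>k\<le>N. G z k) \<le> K"
    proof (cases "gradient (Phi f \<tau>) (z N) = 0")
      case True
      then have "(\<Sum>k\<le>N. G z k) = (\<Sum>k<N. G z k)"
        by (simp add: lessThan_Suc_atMost[symmetric] G_def)
      then show ?thesis using sum[OF gen] by simp
    next
      case False
      then show ?thesis using sum[of "Suc N"] gen by (simp add: generated_Suc lessThan_Suc_atMost)
    qed
    then show ?thesis by (rule Min_le_average)
  qed
  \<comment> \<open>\<open>K\<close> is negative only if \<open>M < 0\<close>, when no run satisfies the bound on the metric;
     the absolute value covers this case.\<close>
  have complexity: "\<exists>k. generated f \<tau> z k \<and> real k \<le> \<bar>K\<bar> / \<epsilon>\<^sup>2 \<and> norm (gradient (Phi f \<tau>) (z k)) \<le> \<epsilon>"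
    if \<epsilon>: "\<epsilon> > 0" and run: "is_run f L \<tau> \<delta> \<theta> c1 \<rho> z0 z b \<mu>"
      and PM: "\<forall>k. generated f \<tau> z k \<longrightarrow> P_matrix f L \<tau> \<delta> (z k) \<preceq>\<^sub>L M *\<^sub>R mat 1" for \<epsilon> z b \<mu>
  proof (rule ccontr)
    assume "\<not> ?thesis"
    then have large: "norm (gradient (Phi f \<tau>) (z k)) > \<epsilon>"
      if "generated f \<tau> z k" "real k \<le> \<bar>K\<bar> / \<epsilon>\<^sup>2" for k
      using that by force
    define N where "N = nat \<lfloor>\<bar>K\<bar> / \<epsilon>\<^sup>2\<rfloor>"
    have N: "real k \<le> \<bar>K\<bar> / \<epsilon>\<^sup>2" if "k \<le> N" for k
    proof -
      have "real k \<le> real N" using that by simp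
      also have "\<dots> \<le> \<bar>K\<bar> / \<epsilon>\<^sup>2" unfolding N_def by (rule of_nat_floor) simp
      finally show ?thesis .
    qed
    have "k \<le> N \<Longrightarrow> generated f \<tau> z k" for k
    proof (induction k)
      case 0
      show ?case by (simp add: generated_def)
    next
      case (Suc k)
      then have "norm (gradient (Phi f \<tau>) (z k)) > \<epsilon>" by (intro large N) auto
      then show ?case using Suc \<epsilon> by (auto simp: generated_Suc)
    qed
    note gen = this
    have "\<forall>y \<in> G z ` {0..N}. \<epsilon>\<^sup>2 < y"
      using large gen N \<epsilon> by (auto simp: G_def intro!: power_strict_mono)
    then have "\<epsilon>\<^sup>2 < Min (G z ` {0..N})" by simp
    also have "\<dots> \<le> K / (real N + 1)" using rate[OF run PM gen] by simp
    also have "\<dots> \<le> \<bar>K\<bar> / (real N + 1)" by (intro divide_right_mono) auto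
    finally have "real N + 1 < \<bar>K\<bar> / \<epsilon>\<^sup>2" using \<epsilon> by (simp add: field_simps)
    moreover have "\<bar>K\<bar> / \<epsilon>\<^sup>2 < real N + 1"
      unfolding N_def by linarith
    ultimately show False by linarith
  qed
  show ?thesis
  proof (intro conjI allI impI; (elim conjE)?)
    fix z b \<mu> N
    assume "is_run f L \<tau> \<delta> \<theta> c1 \<rho> z0 z b \<mu>"
      "\<forall>k. generated f \<tau> z k \<longrightarrow> P_matrix f L \<tau> \<delta> (z k) \<preceq>\<^sub>L M *\<^sub>R mat 1" "generated f \<tau> z N"
    from rate[OF this]
    show "Min ((\<lambda>k. (norm (gradient (Phi f \<tau>) (z k)))\<^sup>2) ` {0..N})
             \<le> M * Phi_gap f \<tau> z0 / (c1 * alpha_low \<theta> c1 \<rho> * (real N + 1))"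
      by (simp add: G_def K_def A_def)
  next
    show "\<exists>C\<ge>0. \<forall>\<epsilon>>0. \<forall>z b \<mu>.
        is_run f L \<tau> \<delta> \<theta> c1 \<rho> z0 z b \<mu> \<and>
        (\<forall>k. generated f \<tau> z k \<longrightarrow> P_matrix f L \<tau> \<delta> (z k) \<preceq>\<^sub>L M *\<^sub>R mat 1) \<longrightarrow>
        (\<exists>k. generated f \<tau> z k \<and> real k \<le> C / \<epsilon>\<^sup>2 \<and>
             norm (gradient (Phi f \<tau>) (z k)) \<le> \<epsilon>)"
      by (intro exI[of _ "\<bar>K\<bar>"] conjI allI impI) (simp, blast intro: complexity)
  qed
qed

end
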